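(* Let $N\ge2$ be an integer and $B>0$. For $t=1,\dots,T$ let $n_t\in\{2,\dots,N\}$ and $b_t\in(0,B]$, and for $x\in[N]=\{1,\dots,N\}$ and $\lambda\in(0,1]$ let $$u_t(x)=b_t1_{x>b_t}+n_t1_{x\le b_t},\qquad U_t(x,\lambda)=\frac{\min\{\lambda u_t(x),b_t,n_t\}}{1-(1+1/b_t)^{-b_t\lambda}}$$ be the competitive-ratio upper bounds of the discrete ski-rental problem. Then the randomized exponentiated gradient algorithm with an appropriate step-size, playing $(x_t,\lambda_t)$ at round $t$, has expected regret $$\max_{x\in[N],\lambda\in(0,1]}\mathbb E\sum_{t=1}^T\big(U_t(x_t,\lambda_t)-U_t(x,\lambda)\big)\le6N\sqrt{T\log(BNT)}.$$
   Context: In discrete ski-rental, instance $t$ is a ski season with an unknown number $n_t$ of days; to ski each day one must either buy skis at price $b_t$ or rent each day for price one. $N$ bounds the number of days and $B$ bounds the buy price. $U_t(x,\lambda)$ is a performance upper bound for an algorithm using prediction $x$ and robustness-consistency trade-off parameter $\lambda$. Randomized exponentiated gradient: fix a finite grid $\Lambda\subset(0,1]$ of spacing $\delta$ (e.g. $\{\delta/2,3\delta/2,\dots,1-\delta/2\}$ with $1/\delta\in\mathbb Z_{\ge2}$), start from the uniform distribution over $[N]\times\Lambda$, sample $(x_t,\lambda_t)$ from the current distribution at each round $t$, then observe $U_t$, multiply the probability of each $(x,\lambda)\in[N]\times\Lambda$ by $\exp(-\alpha U_t(x,\lambda))$, and renormalize. The statement asserts that there are choices of step-size $\alpha>0$ and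 of $\delta$ for which the bound holds. The expectation is over the algorithm's sampling.
   Formalization: The formal theorem adds T≥1 and BNT≥101/100: for BNT<1 the right side is undefined, and at BNT=1 (e.g. N=2, T=1, B=b_1=1/2, n_1=2) it is 0 while the regret is positive; it also fails slightly above 1. The added condition is automatic for B≥1. *)

theory Defs
  imports "HOL-Probability.Probability" "HOL-Probability.Product_PMF"
begin

section \<open>Discrete ski-rental\<close>

text \<open>Here \<open>b\<close> is the buy price, \<open>n\<close> the number of ski days, \<open>x\<close> the predicted number of
  days, and \<open>lam\<close> the robustness-consistency trade-off parameter.\<close>

definition ski_u :: "real \<Rightarrow> nat \<Rightarrow> nat \<Rightarrow> real" where
  "ski_u b n x = (if real x > b then b else real n)"

definition ski_U :: "real \<Rightarrow> nat \<Rightarrow> nat \<Rightarrow> real \<Rightarrow> real" where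
  "ski_U b n x lam =
     Min {lam * ski_u b n x, b, real n} / (1 - (1 + 1 / b) powr (- b * lam))"

text \<open>The cell midpoints \<open>\<delta>/2, 3\<delta>/2, \<dots>, 1 - \<delta>/2\<close>; only used when \<open>1/\<delta>\<close> is an integer.\<close>

definition midpoint_grid :: "real \<Rightarrow> real set" where
  "midpoint_grid \<delta> = {\<delta> / 2 + real k * \<delta> | k. \<delta> / 2 + real k * \<delta> \<le> 1 - \<delta> / 2}"

section \<open>Randomized exponentiated gradient\<close>

text \<open>The distributions have finite support, so the normalizer is a finite sum and the argument of
  \<^const>\<open>embed_pmf\<close> is a genuine probability mass function, see \<open>pmf_eg_update\<close> below.\<close>

definition eg_update :: "real \<Rightarrow> ('a \<Rightarrow> real) \<Rightarrow> 'a pmf \<Rightarrow> 'a pmf" where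
  "eg_update \<alpha> loss p =
     embed_pmf (\<lambda>a. pmf p a * exp (- \<alpha> * loss a) /
                    (\<Sum>c\<in>set_pmf p. pmf p c * exp (- \<alpha> * loss c)))"

text \<open>\<open>eg_law \<alpha> A loss k\<close> is the distribution held after the losses of rounds \<open>1, \<dots>, k\<close> have
  been observed; the action of round \<open>t\<close> is thus drawn from \<open>eg_law \<alpha> A loss (t - 1)\<close>.\<close>

primrec eg_law :: "real \<Rightarrow> 'a set \<Rightarrow> (nat \<Rightarrow> 'a \<Rightarrow> real) \<Rightarrow> nat \<Rightarrow> 'a pmf" where
  "eg_law \<alpha> A loss 0 = pmf_of_set A"
| "eg_law \<alpha> A loss (Suc k) = eg_update \<alpha> (loss (Suc k)) (eg_law \<alpha> A loss k)"

text \<open>The joint law of the actions of rounds \<open>1, \<dots>, T\<close>. The losses do not depend on the actions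
  and the update uses the full loss function, so the sampling distributions are deterministic and
  the draws are independent.\<close>

definition eg_plays ::
  "real \<Rightarrow> 'a set \<Rightarrow> (nat \<Rightarrow> 'a \<Rightarrow> real) \<Rightarrow> nat \<Rightarrow> (nat \<Rightarrow> 'a) pmf" where
  "eg_plays \<alpha> A loss T = Pi_pmf {1..T} undefined (\<lambda>t. eg_law \<alpha> A loss (t - 1))"

lemma pmf_eg_update:
  assumes fin: "finite (set_pmf p)"
  shows "pmf (eg_update \<alpha> loss p) a =
           pmf p a * exp (- \<alpha> * loss a) / (\<Sum>c\<in>set_pmf p. pmf p c * exp (- \<alpha> * loss c))"
proof -
  define w where "w a = pmf p a * exp (- \<alpha> * loss a)" for a
  define Z where "Z = (\<Sum>c\<in>set_pmf p. w c)"
  have w0: "w a \<ge> 0" for a by (simp add: w_def)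
  have Z: "Z > 0"
    unfolding Z_def by (rule sum_pos) (use fin in \<open>auto simp: w_def pmf_positive set_pmf_not_empty\<close>)
  have "(\<integral>\<^sup>+a. ennreal (w a / Z) \<partial>count_space UNIV) = (\<Sum>a\<in>set_pmf p. ennreal (w a / Z))"
    by (rule nn_integral_count_space'[OF fin]) (auto simp: w_def set_pmf_iff)
  also have "\<dots> = ennreal ((\<Sum>a\<in>set_pmf p. w a) / Z)"
    by (subst sum_ennreal) (use w0 Z in \<open>auto simp: sum_divide_distrib\<close>)
  also have "\<dots> = 1" using Z by (simp add: Z_def)
  finally have "pmf (embed_pmf (\<lambda>a. w a / Z)) a = w a / Z"
    using w0 Z by (intro pmf_embed_pmf) auto
  then show ?thesis by (simp add: eg_update_def w_def Z_def)
qed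

lemma set_pmf_eg_update:
  assumes "finite (set_pmf p)"
  shows "set_pmf (eg_update \<alpha> loss p) = set_pmf p"
proof -
  have "(\<Sum>c\<in>set_pmf p. pmf p c * exp (- \<alpha> * loss c)) > 0"
    by (rule sum_pos) (use assms in \<open>auto simp: pmf_positive set_pmf_not_empty\<close>)
  then show ?thesis by (auto simp: set_pmf_iff pmf_eg_update[OF assms])
qed

lemma set_pmf_eg_law:
  assumes "finite A" "A \<noteq> {}"
  shows "set_pmf (eg_law \<alpha> A loss k) = A"
  by (induction k) (use assms in \<open>auto simp: set_pmf_eg_update\<close>)

text \<open>The maximal expected regret over the comparators \<open>(x, \<lambda>) \<in> [N] \<times> (0, 1]\<close>. The maximum over
  \<open>\<lambda>\<close> is read as a supremum, since it need not be attained (the losses can be increasing in \<open>\<lambda>\<close>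
  on the half-open interval); it is taken in \<^typ>\<open>ereal\<close>, where it always exists.\<close>

definition ski_eg_regret ::
  "real \<Rightarrow> real \<Rightarrow> nat \<Rightarrow> nat \<Rightarrow> (nat \<Rightarrow> nat) \<Rightarrow> (nat \<Rightarrow> real) \<Rightarrow> ereal" where
  "ski_eg_regret \<alpha> \<delta> N T n b =
     (SUP (x, lam) \<in> {1..N} \<times> {0<..1::real}. ereal
        (measure_pmf.expectation
          (eg_plays \<alpha> ({1..N} \<times> midpoint_grid \<delta>) (\<lambda>t (y, mu). ski_U (b t) (n t) y mu) T)
          (\<lambda>play. \<Sum>t = 1..T.
             ski_U (b t) (n t) (fst (play t)) (snd (play t)) - ski_U (b t) (n t) x lam)))"

text \<open>For \<open>B < 1\<close> the maximal regret is strictly positive: every played \<open>\<lambda>\<close> is positive, and all losses are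
  strictly increasing in \<open>\<lambda>\<close>. So no bound of the form \<open>C * N * sqrt (T * ln (B * N * T))\<close> can
  hold when \<open>B * N * T \<le> 1\<close>, where the logarithm is nonpositive, nor uniformly as \<open>B * N * T\<close>
  decreases to \<open>1\<close>. The theorem therefore assumes that \<open>B * N * T\<close> exceeds \<open>1\<close> by a fixed small
  margin, which is automatic for \<open>B \<ge> 1\<close>.\<close>

end

theory Submission
  imports Defs
begin

text \<open>The potential argument for exponentiated gradient, with Hoeffding's lemma bounding each
  normalizer, gives regret at most \<open>ln |A| / \<alpha> + \<alpha> T M\<^sup>2 / 8\<close> against a fixed action of a finite
  set \<open>A\<close> when the losses of each round lie in an interval of length \<open>M\<close>. Rounding \<open>\<lambda>\<close> up to the grid
  needs no two-sided Lipschitz bound: where the numerator of the loss is clipped, the loss decreases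
  in \<open>\<lambda>\<close>, and otherwise it is \<open>\<lambda> u / (1 - exp (- L \<lambda>))\<close> with \<open>L = b ln (1 + 1 / b)\<close>, which is
  \<open>u\<close>-Lipschitz. Above the last grid point \<open>\<lambda>\<close> is rounded down, to \<open>\<mu>\<close> say, which costs at most a
  factor \<open>\<lambda> / \<mu>\<close> close to \<open>1\<close>. With spacing \<open>1 / (T + 1)\<close> the discretization costs less than \<open>M\<close>
  in total. For \<open>B \<ge> 1\<close> one can take \<open>M = 3 N\<close>. For \<open>B < 1\<close> the losses do not depend on \<open>x\<close> and vary
  by at most \<open>M = B\<close>; then either the trivial bound \<open>B T\<close> suffices or \<open>B N T\<close> is so large that
  \<open>T \<le> (B N T)\<^sup>2\<close> and the logarithm of the grid size is of the order of the target.\<close>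

section \<open>Regret of exponentiated gradient\<close>

text \<open>Hoeffding's lemma for \<open>- f\<close>. Only the length \<open>M\<close> of the
  interval enters, not its position \<open>a\<close>.\<close>

lemma ln_mgf_pmf_le:
  fixes f :: "'a \<Rightarrow> real"
  assumes fin: "finite (set_pmf p)" and "\<alpha> > 0"
    and bnd: "\<And>c. c \<in> set_pmf p \<Longrightarrow> f c \<in> {a..a + M}"
  shows "ln (\<Sum>c\<in>set_pmf p. pmf p c * exp (- \<alpha> * f c))
           \<le> - \<alpha> * measure_pmf.expectation p f + \<alpha>\<^sup>2 * M\<^sup>2 / 8"
proof -
  define \<mu> where "\<mu> = measure_pmf.expectation p f"
  define Z where "Z = (\<Sum>c\<in>set_pmf p. pmf p c * exp (- \<alpha> * f c))"
  have "- a - M \<le> - f c \<and> - f c \<le> - a" if "c \<in> set_pmf p" for c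
    using bnd[OF that] by simp
  then interpret interval_bounded_random_variable p "\<lambda>c. - f c" "- a - M" "- a"
    by unfold_locales (auto simp: AE_measure_pmf_iff)
  have "Z > 0"
    unfolding Z_def by (rule sum_pos) (use fin in \<open>auto simp: pmf_positive set_pmf_not_empty\<close>)
  have "nn_integral p (\<lambda>c. ennreal (exp (\<alpha> * (- f c - measure_pmf.expectation p (\<lambda>c. - f c)))))
          \<le> ennreal (exp (\<alpha>\<^sup>2 * (- a - (- a - M))\<^sup>2 / 8))"
    by (rule Hoeffdings_lemma_nn_integral) fact
  also have "(\<lambda>c. \<alpha> * (- f c - measure_pmf.expectation p (\<lambda>c. - f c))) = (\<lambda>c. \<alpha> * \<mu> + - \<alpha> * f c)"
    by (simp add: \<mu>_def algebra_simps)
  also have "nn_integral p (\<lambda>c. ennreal (exp (\<alpha> * \<mu> + - \<alpha> * f c)))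
      = (\<Sum>c\<in>set_pmf p. ennreal (exp (\<alpha> * \<mu> + - \<alpha> * f c)) * pmf p c)"
    using fin by (intro nn_integral_measure_pmf_finite) auto
  also have "\<dots> = ennreal (\<Sum>c\<in>set_pmf p. exp (\<alpha> * \<mu> + - \<alpha> * f c) * pmf p c)"
    by (simp flip: sum_ennreal ennreal_mult)
  also have "(\<Sum>c\<in>set_pmf p. exp (\<alpha> * \<mu> + - \<alpha> * f c) * pmf p c) = exp (\<alpha> * \<mu>) * Z"
    by (simp add: Z_def sum_distrib_left exp_diff exp_minus field_simps)
  finally have "exp (\<alpha> * \<mu>) * Z \<le> exp (\<alpha>\<^sup>2 * M\<^sup>2 / 8)"
    by (simp add: ennreal_le_iff)
  with \<open>Z > 0\<close> have "ln (exp (\<alpha> * \<mu>) * Z) \<le> ln (exp (\<alpha>\<^sup>2 * M\<^sup>2 / 8))"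
    by (subst ln_le_cancel_iff) auto
  with \<open>Z > 0\<close> show ?thesis
    by (simp add: ln_mult \<mu>_def Z_def)
qed

text \<open>The potential is the log-probability of the comparator \<open>c\<close>: it starts at
  \<open>- ln (card A)\<close>, stays nonpositive, and gains \<open>- \<alpha> * loss - ln Z\<close>
  in each round. The offset \<open>a t\<close> may change from round to round.\<close>

lemma eg_law_regret:
  fixes loss :: "nat \<Rightarrow> 'a \<Rightarrow> real"
  assumes A: "finite A" "c \<in> A" and "\<alpha> > 0"
    and bnd: "\<And>t c. t \<in> {1..T} \<Longrightarrow> c \<in> A \<Longrightarrow> loss t c \<in> {a t..a t + M}"
  shows "(\<Sum>t = 1..T. measure_pmf.expectation (eg_law \<alpha> A loss (t - 1)) (loss t) - loss t c)
           \<le> ln (card A) / \<alpha> + \<alpha> * T * M\<^sup>2 / 8"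
proof -
  have "A \<noteq> {}" using A by auto
  define P where "P k = pmf (eg_law \<alpha> A loss k) c" for k
  note set_law = set_pmf_eg_law[OF A(1) \<open>A \<noteq> {}\<close>]
  have P: "0 < P k" "P k \<le> 1" for k
    using A set_law[of \<alpha> loss k] by (auto simp: P_def pmf_positive_iff pmf_le_1)
  have step: "\<alpha> * (measure_pmf.expectation (eg_law \<alpha> A loss k) (loss (Suc k)) - loss (Suc k) c)
      \<le> ln (P (Suc k)) - ln (P k) + \<alpha>\<^sup>2 * M\<^sup>2 / 8" if "k < T" for k
  proof -
    define Z where "Z = (\<Sum>c\<in>A. pmf (eg_law \<alpha> A loss k) c * exp (- \<alpha> * loss (Suc k) c))"
    have "Z > 0"
      unfolding Z_def
      by (rule sum_pos) (use A \<open>A \<noteq> {}\<close> set_law[of \<alpha> loss k] in \<open>auto simp: pmf_positive\<close>)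
    have "P (Suc k) = P k * exp (- \<alpha> * loss (Suc k) c) / Z"
      using A(1) by (simp add: P_def pmf_eg_update set_law Z_def)
    then have "ln (P (Suc k)) = ln (P k) - \<alpha> * loss (Suc k) c - ln Z"
      using P(1)[of k] \<open>Z > 0\<close> by (simp add: ln_div ln_mult)
    moreover have "ln Z \<le> - \<alpha> * measure_pmf.expectation (eg_law \<alpha> A loss k) (loss (Suc k)) + \<alpha>\<^sup>2 * M\<^sup>2 / 8"
      using ln_mgf_pmf_le[of "eg_law \<alpha> A loss k" \<alpha> "loss (Suc k)" "a (Suc k)" M]
        bnd[of "Suc k"] that A(1) \<open>\<alpha> > 0\<close> by (simp add: set_law Z_def)
    ultimately show ?thesis by (simp add: algebra_simps)
  qed
  \<comment> \<open>Round \<open>t = k + 1\<close> draws from the law held after \<open>k\<close>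
    rounds.\<close>
  have "\<alpha> * (\<Sum>t = 1..T. measure_pmf.expectation (eg_law \<alpha> A loss (t - 1)) (loss t) - loss t c)
      = (\<Sum>k<T. \<alpha> * (measure_pmf.expectation (eg_law \<alpha> A loss k) (loss (Suc k)) - loss (Suc k) c))"
    unfolding sum_distrib_left
    by (rule sum.reindex_bij_witness[where i = Suc and j = "\<lambda>t. t - 1"]) auto
  also have "\<dots> \<le> (\<Sum>k<T. ln (P (Suc k)) - ln (P k) + \<alpha>\<^sup>2 * M\<^sup>2 / 8)"
    by (intro sum_mono step) auto
  also have "\<dots> = ln (P T) - ln (P 0) + T * (\<alpha>\<^sup>2 * M\<^sup>2 / 8)"
    using sum_lessThan_telescope[of "\<lambda>k. ln (P k)" T] by (simp add: sum.distrib)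
  also have "ln (P T) \<le> 0" using P[of T] by simp
  also have "ln (P 0) = - ln (card A)"
    using A \<open>A \<noteq> {}\<close> by (simp add: P_def ln_div)
  finally show ?thesis
    using \<open>\<alpha> > 0\<close> by (simp add: field_simps power2_eq_square)
qed

text \<open>Linearity of expectation reduces the product law to its marginals.\<close>

lemma expectation_eg_plays_sum:
  fixes loss :: "nat \<Rightarrow> 'a \<Rightarrow> real" and h :: "nat \<Rightarrow> 'a \<Rightarrow> real"
  assumes A: "finite A" "A \<noteq> {}"
  shows "measure_pmf.expectation (eg_plays \<alpha> A loss T) (\<lambda>play. \<Sum>t = 1..T. h t (play t))
     = (\<Sum>t = 1..T. measure_pmf.expectation (eg_law \<alpha> A loss (t - 1)) (h t))"
proof -
  note law = set_pmf_eg_law[OF A]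
  have comp: "map_pmf (\<lambda>play. play t) (eg_plays \<alpha> A loss T) = eg_law \<alpha> A loss (t - 1)"
    if "t \<in> {1..T}" for t
    using that by (simp add: eg_plays_def Pi_pmf_component)
  have int: "integrable (eg_plays \<alpha> A loss T) (\<lambda>play. h t (play t))" if "t \<in> {1..T}" for t
  proof -
    have "integrable (map_pmf (\<lambda>play. play t) (eg_plays \<alpha> A loss T)) (h t)"
      unfolding comp[OF that] by (rule integrable_measure_pmf_finite) (simp add: law A)
    then show ?thesis by simp
  qed
  have "measure_pmf.expectation (eg_plays \<alpha> A loss T) (\<lambda>play. h t (play t))
      = measure_pmf.expectation (eg_law \<alpha> A loss (t - 1)) (h t)" if "t \<in> {1..T}" for t
    unfolding comp[OF that, symmetric] by simp
  with int show ?thesis by (simp add: Bochner_Integration.integral_sum)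
qed

section \<open>Ski-rental losses\<close>

lemma one_minus_exp_ratio_bounds:
  assumes "(z::real) > 0"
  shows "1 \<le> z / (1 - exp (- z))" "z / (1 - exp (- z)) \<le> 1 + z"
proof -
  have *: "1 - exp (- z) > 0" using assms by simp
  show "1 \<le> z / (1 - exp (- z))"
    using * exp_ge_add_one_self[of "- z"] by (simp add: le_divide_eq)
  have "(1 + z) * exp (- z) \<le> exp z * exp (- z)"
    by (intro mult_right_mono exp_ge_add_one_self) auto
  also have "\<dots> = 1" by (simp flip: exp_add)
  finally show "z / (1 - exp (- z)) \<le> 1 + z"
    using * by (simp add: field_simps)
qed

text \<open>By convexity, \<open>exp\<close> at \<open>- z\<close> lies below its chord from
  \<open>0\<close> to \<open>- w\<close>.\<close>

lemma one_minus_exp_ratio_mono: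
  assumes "0 < z" "z \<le> (w::real)"
  shows "z / (1 - exp (- z)) \<le> w / (1 - exp (- w))"
proof -
  have "exp (- z) = exp ((1 - z / w) *\<^sub>R 0 + (z / w) *\<^sub>R (- w))" using assms by simp
  also have "\<dots> \<le> (1 - z / w) * exp 0 + (z / w) * exp (- w)"
    using assms exp_convex by (intro convex_onD) auto
  finally have "z / w * (1 - exp (- w)) \<le> 1 - exp (- z)" by (simp add: algebra_simps)
  then show ?thesis using assms by (simp add: field_simps)
qed

text \<open>The ratio equals \<open>v + v / (exp v - 1)\<close>, whose second summand decreases by
  the chord inequality for \<open>exp\<close> on \<open>[0, w]\<close>.\<close>

lemma one_minus_exp_ratio_lipschitz:
  assumes "0 < z" "z \<le> (w::real)"
  shows "w / (1 - exp (- w)) \<le> z / (1 - exp (- z)) + (w - z)"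
proof -
  have eq: "v / (1 - exp (- v)) = v + v / (exp v - 1)" if "v > 0" for v :: real
    using that by (simp add: exp_minus field_simps)
  have "exp z = exp ((1 - z / w) *\<^sub>R 0 + (z / w) *\<^sub>R w)" using assms by simp
  also have "\<dots> \<le> (1 - z / w) * exp 0 + (z / w) * exp w"
    using assms exp_convex by (intro convex_onD) auto
  finally have "exp z - 1 \<le> z / w * (exp w - 1)" by (simp add: algebra_simps)
  then have "w / (exp w - 1) \<le> z / (exp z - 1)" using assms by (simp add: field_simps)
  then show ?thesis using assms by (simp add: eq)
qed

section \<open>Closed form and size of the losses\<close>

lemma ski_u_bounds:
  assumes "b > 0" "n \<in> {2..N}" "x \<in> {1..N}"
  shows "0 < ski_u b n x" "ski_u b n x \<le> real N" "b < 1 \<Longrightarrow> ski_u b n x = b"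
  using assms by (auto simp: ski_u_def)

text \<open>The \<open>L\<close> of the overview:
  \<open>(1 + 1 / b) powr (- b * lam) = exp (- (L * lam))\<close>.\<close>

definition ski_rate :: "real \<Rightarrow> real" where
  "ski_rate b = b * ln (1 + 1 / b)"

text \<open>The second bound rests on \<open>ln (1 + 1 / b) \<ge> 1 / (b + 1)\<close>, which is
  \<open>ln y \<le> y - 1\<close> at \<open>y = b / (b + 1)\<close>.\<close>

lemma ski_rate_bounds:
  assumes "b > 0"
  shows "0 < ski_rate b" "1 / ski_rate b \<le> 1 + 1 / b"
proof -
  show pos: "0 < ski_rate b"
    using assms by (auto simp: ski_rate_def intro!: mult_pos_pos ln_gt_zero)
  have "ln (b / (b + 1)) \<le> b / (b + 1) - 1"
    using assms by (intro ln_le_minus_one) auto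
  moreover have "b / (b + 1) - 1 = - (1 / (b + 1))"
    using assms by (simp add: field_simps)
  moreover have "1 + 1 / b = inverse (b / (b + 1))"
    using assms by (simp add: field_simps)
  then have "ln (1 + 1 / b) = - ln (b / (b + 1))"
    using assms by (simp only: ln_inverse)
  ultimately have "1 / (b + 1) \<le> ln (1 + 1 / b)" by linarith
  from mult_left_mono[OF this, of b] have "b / (b + 1) \<le> ski_rate b"
    using assms by (simp add: ski_rate_def)
  then have "1 / ski_rate b \<le> 1 / (b / (b + 1))"
    using assms pos by (intro divide_left_mono) auto
  then show "1 / ski_rate b \<le> 1 + 1 / b"
    using assms by (simp add: field_simps)
qed

lemma ski_U_eq:
  assumes "b > 0"
  shows "ski_U b n x lam =
    min (lam * ski_u b n x) (min b (real n)) / (1 - exp (- (ski_rate b * lam)))"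
  using assms by (simp add: ski_U_def ski_rate_def powr_def add_pos_pos less_imp_neq[THEN not_sym] mult_ac)

lemma ski_U_denominator_pos:
  assumes "b > 0" "lam > 0"
  shows "1 - exp (- (ski_rate b * lam)) > 0"
  using assms ski_rate_bounds(1)[of b] by simp

lemma ski_U_unclipped_eq:
  assumes "b > 0" "lam > 0"
  shows "lam * u / (1 - exp (- (ski_rate b * lam))) =
    u / ski_rate b * (ski_rate b * lam / (1 - exp (- (ski_rate b * lam))))"
  using assms ski_rate_bounds(1)[of b] by simp

lemma ski_U_nonneg:
  assumes "b > 0" "n \<in> {2..N}" "x \<in> {1..N}" "lam > 0"
  shows "ski_U b n x lam \<ge> 0"
  using assms ski_u_bounds[of b n N x] ski_U_denominator_pos[of b lam] by (simp add: ski_U_eq)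

text \<open>Dropping the clipping leaves \<open>u / L + u * lam\<close>, at most
  \<open>2 * u + u / b\<close>; each of the three units is at most \<open>N\<close>.\<close>

lemma ski_U_le:
  assumes "b > 0" "n \<in> {2..N}" "x \<in> {1..N}" "lam \<in> {0<..1}"
  shows "ski_U b n x lam \<le> 3 * N"
proof -
  let ?u = "ski_u b n x" and ?L = "ski_rate b"
  note u = ski_u_bounds[OF assms(1-3)] and L = ski_rate_bounds[OF \<open>b > 0\<close>]
  have "ski_U b n x lam \<le> lam * ?u / (1 - exp (- (?L * lam)))"
    using assms ski_U_denominator_pos[of b lam] unfolding ski_U_eq[OF \<open>b > 0\<close>]
    by (intro divide_right_mono) auto
  also have "\<dots> = ?u / ?L * (?L * lam / (1 - exp (- (?L * lam))))"
    using assms by (intro ski_U_unclipped_eq) auto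
  also have "\<dots> \<le> ?u / ?L * (1 + ?L * lam)"
    using assms L u by (intro mult_left_mono one_minus_exp_ratio_bounds) auto
  also have "\<dots> = ?u * (1 / ?L) + ?u * lam"
    using L by (simp add: field_simps)
  also have "\<dots> \<le> ?u * (1 + 1 / b) + ?u * 1"
    using assms L u by (intro add_mono mult_left_mono) auto
  also have "\<dots> = 2 * ?u + ?u / b"
    by (simp add: algebra_simps)
  also have "\<dots> \<le> 3 * N"
  \<comment> \<open>For \<open>b < 1\<close> the quotient \<open>u / b\<close> is \<open>1\<close>,
    since then \<open>u = b\<close>; otherwise it is at most \<open>u\<close>.\<close>
  proof (cases "b < 1")
    case True
    then show ?thesis using u assms by auto
  next
    case False
    then have "?u / b \<le> ?u / 1" using u by (intro divide_left_mono) auto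
    then show ?thesis using u by linarith
  qed
  finally show ?thesis .
qed

text \<open>Every \<open>x \<ge> 1\<close> exceeds \<open>b\<close>, so \<open>u = b\<close> and the
  clipping never bites. The loss depends on neither \<open>x\<close> nor \<open>n\<close>.\<close>

lemma ski_U_cheap_eq:
  assumes "0 < b" "b < 1" "n \<ge> 2" "x \<ge> 1" "lam \<in> {0<..1}"
  shows "ski_U b n x lam =
    b / ski_rate b * (ski_rate b * lam / (1 - exp (- (ski_rate b * lam))))"
proof -
  have "lam * b \<le> b" using assms by (simp add: mult_le_cancel_right1)
  moreover have "ski_u b n x = b" using assms by (simp add: ski_u_def)
  ultimately have "min (lam * ski_u b n x) (min b (real n)) = lam * b" using assms by auto
  then show ?thesis
    using assms ski_U_unclipped_eq[of b lam b] by (simp add: ski_U_eq)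
qed

text \<open>The offset \<open>b / L = 1 / ln (1 + 1 / b)\<close> is not of order \<open>b\<close>,
  but it is common to all actions and cancels in the regret.\<close>

lemma ski_U_cheap_bounds:
  assumes "0 < b" "b < 1" "n \<ge> 2" "x \<ge> 1" "lam \<in> {0<..1}"
  shows "ski_U b n x lam \<in> {b / ski_rate b..b / ski_rate b + b}"
proof -
  let ?L = "ski_rate b"
  note L = ski_rate_bounds[OF \<open>b > 0\<close>]
  have "?L * lam > 0" using L assms by simp
  note g = one_minus_exp_ratio_bounds[OF this]
  have "b / ?L * 1 \<le> ski_U b n x lam"
    unfolding ski_U_cheap_eq[OF assms] by (intro mult_left_mono g) (use L assms in auto)
  moreover have "ski_U b n x lam \<le> b / ?L * (1 + ?L * lam)"
    unfolding ski_U_cheap_eq[OF assms] by (intro mult_left_mono g) (use L assms in auto)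
  moreover have "b / ?L * (1 + ?L * lam) = b / ?L + b * lam"
    using L by (simp add: field_simps)
  moreover have "b * lam \<le> b" using assms by simp
  ultimately show ?thesis by (auto intro: order_trans)
qed

section \<open>Effect of rounding \<open>lam\<close>\<close>

lemma ski_U_round_up:
  assumes "b > 0" "n \<in> {2..N}" "x \<in> {1..N}" "0 < lam" "lam \<le> mu"
  shows "ski_U b n x mu \<le> ski_U b n x lam + ski_u b n x * (mu - lam)"
proof -
  let ?u = "ski_u b n x" and ?L = "ski_rate b" and ?c = "min b (real n)"
  let ?D = "\<lambda>l. 1 - exp (- (?L * l))"
  note u = ski_u_bounds[OF assms(1-3)] and L = ski_rate_bounds[OF \<open>b > 0\<close>]
  note D = ski_U_denominator_pos[OF \<open>b > 0\<close>]
  have "mu > 0" using assms by simp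
  show ?thesis
  \<comment> \<open>Unclipped at \<open>lam\<close>: the unclipped expression bounds the loss at
    \<open>mu\<close> and is \<open>u\<close>-Lipschitz. Clipped at \<open>lam\<close>: the
    numerator cannot grow further while the denominator does.\<close>
  proof (cases "lam * ?u \<le> ?c")
    case True
    have "ski_U b n x mu \<le> mu * ?u / ?D mu"
      using D[OF \<open>mu > 0\<close>] unfolding ski_U_eq[OF \<open>b > 0\<close>] by (intro divide_right_mono) auto
    also have "\<dots> = ?u / ?L * (?L * mu / ?D mu)"
      using assms by (intro ski_U_unclipped_eq) auto
    also have "\<dots> \<le> ?u / ?L * (?L * lam / ?D lam + (?L * mu - ?L * lam))"
      using assms L u by (intro mult_left_mono one_minus_exp_ratio_lipschitz) auto
    also have "\<dots> = ?u / ?L * (?L * lam / ?D lam) + ?u / ?L * (?L * mu - ?L * lam)"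
      by (rule distrib_left)
    also have "?u / ?L * (?L * lam / ?D lam) = lam * ?u / ?D lam"
      using assms by (intro ski_U_unclipped_eq[symmetric]) auto
    also have "?u / ?L * (?L * mu - ?L * lam) = ?u * (mu - lam)"
      using L by (simp add: field_simps)
    also have "lam * ?u / ?D lam = ski_U b n x lam"
      using True assms by (simp add: ski_U_eq)
    finally show ?thesis .
  next
    case False
    have "ski_U b n x mu \<le> ?c / ?D mu"
      using D[OF \<open>mu > 0\<close>] unfolding ski_U_eq[OF \<open>b > 0\<close>] by (intro divide_right_mono) auto
    also have "\<dots> \<le> ?c / ?D lam"
      using assms L D[OF \<open>mu > 0\<close>] D[of lam] by (intro divide_left_mono) auto
    also have "\<dots> = ski_U b n x lam"
    proof -
      have "min (lam * ?u) ?c = ?c" using False by (intro min_absorb2 less_imp_le) (simp only: not_le)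
      then show ?thesis by (simp only: ski_U_eq[OF \<open>b > 0\<close>])
    qed
    also have "\<dots> \<le> ski_U b n x lam + ?u * (mu - lam)"
      using u assms by simp
    finally show ?thesis .
  qed
qed

text \<open>The numerator is nondecreasing in \<open>lam\<close>, and monotonicity of the ratio
  bounds the growth of \<open>1 / D\<close> by the factor \<open>lam / mu\<close>.\<close>

lemma ski_U_round_down:
  assumes "b > 0" "n \<in> {2..N}" "x \<in> {1..N}" "0 < mu" "mu \<le> lam"
  shows "ski_U b n x mu \<le> ski_U b n x lam * (lam / mu)"
proof -
  let ?u = "ski_u b n x" and ?L = "ski_rate b" and ?c = "min b (real n)"
  let ?D = "\<lambda>l. 1 - exp (- (?L * l))"
  note u = ski_u_bounds[OF assms(1-3)] and L = ski_rate_bounds[OF \<open>b > 0\<close>]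
  note D = ski_U_denominator_pos[OF \<open>b > 0\<close>]
  have "?L * mu / ?D mu \<le> ?L * lam / ?D lam"
    using assms L by (intro one_minus_exp_ratio_mono) auto
  then have "?L * (mu / ?D mu) \<le> ?L * (lam / ?D lam)" by simp
  then have "mu / ?D mu \<le> lam / ?D lam"
    using L by (simp only: mult_le_cancel_left_pos)
  from divide_right_mono[OF this, of mu] have *: "1 / ?D mu \<le> 1 / ?D lam * (lam / mu)"
    using assms by simp
  have "min (mu * ?u) ?c \<le> min (lam * ?u) ?c"
    using assms u by (intro min.mono mult_right_mono) auto
  then have "ski_U b n x mu \<le> min (lam * ?u) ?c * (1 / ?D mu)"
    using assms D[of mu] unfolding ski_U_eq[OF \<open>b > 0\<close>] by (simp add: divide_right_mono)
  also have "\<dots> \<le> min (lam * ?u) ?c * (1 / ?D lam * (lam / mu))"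
    using assms u by (intro mult_left_mono *) auto
  also have "\<dots> = ski_U b n x lam * (lam / mu)"
    using assms by (simp add: ski_U_eq)
  finally show ?thesis .
qed

text \<open>Rounding down is free here. The multiplicative error of \<open>ski_U_round_down\<close>
  would be relative to \<open>b / L\<close>, hence too large for a range of order
  \<open>b\<close>.\<close>

lemma ski_U_cheap_mono:
  assumes "0 < b" "b < 1" "n \<ge> 2" "x \<ge> 1" "0 < mu" "mu \<le> lam" "lam \<le> 1"
  shows "ski_U b n x mu \<le> ski_U b n x lam"
proof -
  note L = ski_rate_bounds[OF \<open>b > 0\<close>]
  show ?thesis
    using assms L
    by (simp only: ski_U_cheap_eq greaterThanAtMost_iff order_trans[OF \<open>mu \<le> lam\<close> \<open>lam \<le> 1\<close>]
        less_le_trans[OF \<open>0 < mu\<close> \<open>mu \<le> lam\<close>]) (intro mult_left_mono one_minus_exp_ratio_mono; auto)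
qed

section \<open>Discretization\<close>

lemma midpoint_grid_eq:
  assumes "m > 0"
  shows "midpoint_grid (1 / real m) = (\<lambda>k. 1 / real m / 2 + real k * (1 / real m)) ` {..<m}"
proof -
  have "1 / real m / 2 + real k * (1 / real m) \<le> 1 - 1 / real m / 2 \<longleftrightarrow> k < m" for k
  proof -
    have "1 / real m / 2 + real k * (1 / real m) \<le> 1 - 1 / real m / 2 \<longleftrightarrow> (real k + 1) / real m \<le> 1"
      by (simp add: add_divide_distrib) linarith
    also have "\<dots> \<longleftrightarrow> real k + 1 \<le> real m"
      using assms by simp
    finally show ?thesis by linarith
  qed
  then show ?thesis by (auto simp: midpoint_grid_def)
qed

lemma card_midpoint_grid:
  assumes "m > 0"
  shows "finite (midpoint_grid (1 / real m))" "card (midpoint_grid (1 / real m)) = m"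
proof -
  have "inj_on (\<lambda>k. 1 / real m / 2 + real k * (1 / real m)) {..<m}"
    using assms by (auto intro!: inj_onI simp: field_simps)
  then show "finite (midpoint_grid (1 / real m))" "card (midpoint_grid (1 / real m)) = m"
    using assms by (simp_all add: midpoint_grid_eq card_image)
qed

lemma midpoint_grid_subset:
  assumes "\<delta> > 0"
  shows "midpoint_grid \<delta> \<subseteq> {0<..1}"
  using assms by (auto simp: midpoint_grid_def add_pos_nonneg)

lemma midpoint_grid_round_up:
  assumes "m > 0" "0 < lam" "lam \<le> 1 - 1 / real m / 2"
  obtains mu where "mu \<in> midpoint_grid (1 / real m)" "lam \<le> mu" "mu \<le> lam + 1 / real m"
proof -
  \<comment> \<open>The least \<open>k\<close> whose midpoint \<open>(k + 1 / 2) / m\<close> is at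
    least \<open>lam\<close>.\<close>
  define k where "k = nat \<lceil>lam * m - 1 / 2\<rceil>"
  have "lam * m - 1 / 2 \<le> real m - 1" using assms by (simp add: field_simps)
  then have "\<lceil>lam * m - 1 / 2\<rceil> \<le> int m - 1" unfolding ceiling_le_iff by simp
  then have "k < m" using assms by (simp add: k_def)
  \<comment> \<open>The ceiling of a number above \<open>- 1 / 2\<close> is nonnegative, so
    \<open>nat\<close> does not truncate.\<close>
  have "lam * m > 0" using assms by simp
  then have "\<lceil>lam * m - 1 / 2\<rceil> \<ge> 0" by simp
  then have k: "real k = of_int \<lceil>lam * m - 1 / 2\<rceil>" by (simp add: k_def)
  have "lam * m - 1 / 2 \<le> real k" "real k \<le> lam * m + 1 / 2"
    unfolding k by linarith+
  then have "(lam * m - 1 / 2) / m \<le> real k / m" "real k / m \<le> (lam * m + 1 / 2) / m"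
    by (simp_all only: divide_right_mono of_nat_0_le_iff)
  then have "lam \<le> 1 / real m / 2 + real k * (1 / real m)"
    "1 / real m / 2 + real k * (1 / real m) \<le> lam + 1 / real m"
    using assms by (simp_all add: diff_divide_distrib add_divide_distrib)
  with \<open>k < m\<close> assms show thesis
    by (intro that[of "1 / real m / 2 + real k * (1 / real m)"]) (auto simp: midpoint_grid_eq)
qed

text \<open>For \<open>B < 1\<close> a range of
  order \<open>B\<close> is essential, since the target bound then degenerates as \<open>B * N * T\<close> decreases to 1.\<close>

definition ski_range :: "real \<Rightarrow> nat \<Rightarrow> real" where
  "ski_range B N = (if B < 1 then B else 3 * real N)"

text \<open>The lower end \<open>a\<close> may depend on \<open>b\<close>, but on no action, as
  \<open>eg_law_regret\<close> requires.\<close>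

lemma ski_U_in_range:
  assumes "b \<in> {0<..B}" "n \<in> {2..N}" "x \<in> {1..N}" "lam \<in> {0<..1}"
  defines "a \<equiv> (if B < 1 then b / ski_rate b else 0)"
  shows "ski_U b n x lam \<in> {a..a + ski_range B N}"
proof (cases "B < 1")
  case True
  with assms ski_U_cheap_bounds[of b n x lam] show ?thesis
    by (auto simp: ski_range_def)
next
  case False
  with assms ski_U_nonneg[of b n N x lam] ski_U_le[of b n N x lam] show ?thesis
    by (auto simp: ski_range_def)
qed

text \<open>The point \<open>mu\<close> is chosen before the instance, so one fixed comparator
  serves all rounds.\<close>

lemma ski_U_discretization:
  assumes "m \<ge> 2" "lam \<in> {0<..1}"
  obtains mu where "mu \<in> midpoint_grid (1 / real m)"
    "\<And>B N b n x. b \<in> {0<..B} \<Longrightarrow> n \<in> {2..N} \<Longrightarrow> x \<in> {1..N} \<Longrightarrow>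
       ski_U b n x mu \<le> ski_U b n x lam + ski_range B N / m"
proof (cases "lam \<le> 1 - 1 / real m / 2")
  case True
  then obtain mu where mu: "mu \<in> midpoint_grid (1 / real m)" "lam \<le> mu" "mu \<le> lam + 1 / real m"
    using midpoint_grid_round_up[of m lam] assms by auto
  show thesis
  proof (rule that[OF mu(1)])
    fix B b :: real and N n x :: nat
    assume *: "b \<in> {0<..B}" "n \<in> {2..N}" "x \<in> {1..N}"
    have u: "0 < ski_u b n x" "ski_u b n x \<le> ski_range B N"
      using ski_u_bounds[of b n N x] * by (auto simp: ski_range_def)
    have "ski_U b n x mu \<le> ski_U b n x lam + ski_u b n x * (mu - lam)"
      using * mu assms by (intro ski_U_round_up) auto
    also have "ski_u b n x * (mu - lam) \<le> ski_range B N * (1 / m)"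
      using u mu by (intro mult_mono) auto
    finally show "ski_U b n x mu \<le> ski_U b n x lam + ski_range B N / m" by simp
  qed
next
  case False
  \<comment> \<open>The last grid point, of index \<open>m - 1\<close>.\<close>
  define mu where "mu = 1 - 1 / real m / 2"
  have half: "1 / real m \<le> 1 / 2" using assms by (simp add: field_simps)
  have mu: "mu \<ge> 1 / 2" "mu \<le> lam" "lam - mu \<le> 1 / m / 2"
    using half False assms by (auto simp: mu_def)
  have mu_eq: "mu = 1 / real m / 2 + real (m - 1) * (1 / real m)"
    using assms by (simp add: mu_def field_simps of_nat_diff)
  have "m > 0" using assms by simp
  have "mu \<in> midpoint_grid (1 / real m)"
    unfolding midpoint_grid_eq[OF \<open>m > 0\<close>] mu_eq by (rule imageI) (use \<open>m > 0\<close> in simp)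
  then show thesis
  proof (rule that)
    fix B b :: real and N n x :: nat
    assume *: "b \<in> {0<..B}" "n \<in> {2..N}" "x \<in> {1..N}"
    show "ski_U b n x mu \<le> ski_U b n x lam + ski_range B N / m"
    proof (cases "B < 1")
      case True
      then have "ski_U b n x mu \<le> ski_U b n x lam"
        using * mu assms by (intro ski_U_cheap_mono) auto
      also have "\<dots> \<le> ski_U b n x lam + ski_range B N / m"
        using * True by (simp add: ski_range_def)
      finally show ?thesis .
    next
      case False
      have "ski_U b n x mu \<le> ski_U b n x lam * (lam / mu)"
        using * mu by (intro ski_U_round_down) auto
      also have "\<dots> = ski_U b n x lam + ski_U b n x lam * ((lam - mu) / mu)"
        using mu by (simp add: field_simps)
      \<comment> \<open>The gap is at most half a cell and \<open>mu \<ge> 1 / 2\<close>, so the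
        relative error is at most \<open>1 / m\<close>.\<close>
      also have "ski_U b n x lam * ((lam - mu) / mu) \<le> 3 * real N * ((1 / m / 2) / (1 / 2))"
        using * mu assms ski_U_le[of b n N x lam]
        by (intro mult_mono frac_le) auto
      finally show ?thesis using False by (simp add: ski_range_def)
    qed
  qed
qed

text \<open>The first bound holds because expected and comparator losses share an interval of length
  \<open>M\<close> in each round. The second adds the rounding cost \<open>M / m\<close> per round
  to the regret on the grid.\<close>

lemma ski_regret_le:
  fixes n :: "nat \<Rightarrow> nat" and b :: "nat \<Rightarrow> real"
  assumes inst: "\<And>t. t \<in> {1..T} \<Longrightarrow> n t \<in> {2..N} \<and> b t \<in> {0<..B}"
    and "N \<ge> 2" "B > 0" "m \<ge> 2" "\<alpha> > 0"
  defines "M \<equiv> ski_range B N"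
  shows "ski_eg_regret \<alpha> (1 / m) N T n b \<le> ereal (T * M)"
    and "ski_eg_regret \<alpha> (1 / m) N T n b
           \<le> ereal (ln (real N * real m) / \<alpha> + \<alpha> * T * M\<^sup>2 / 8 + T * M / m)"
proof -
  define A where "A = {1..N} \<times> midpoint_grid (1 / real m)"
  define U where "U = (\<lambda>t (y, mu). ski_U (b t) (n t) y mu)"
  define E where "E t = measure_pmf.expectation (eg_law \<alpha> A U (t - 1)) (U t)" for t
  define a where "a t = (if B < 1 then b t / ski_rate (b t) else 0)" for t
  have A: "finite A" "card A = N * m"
    using card_midpoint_grid[of m] assms by (auto simp: A_def card_cartesian_product)
  then have "A \<noteq> {}" using assms by auto
  have law: "set_pmf (eg_law \<alpha> A U k) = A" for k
    by (rule set_pmf_eg_law) fact+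
  have "A \<subseteq> {1..N} \<times> {0<..1}"
    using midpoint_grid_subset[of "1 / real m"] assms by (auto simp: A_def)
  have range: "U t c \<in> {a t..a t + M}" if "t \<in> {1..T}" "c \<in> {1..N} \<times> {0<..1}" for t c
    using ski_U_in_range[of "b t" B "n t" N "fst c" "snd c"] inst[OF that(1)] that(2)
    by (auto simp: U_def a_def M_def split: prod.splits)
  have E_le: "E t \<le> a t + M" if "t \<in> {1..T}" for t
  proof -
    have U_le: "U t c \<le> a t + M" if "c \<in> A" for c
      using range[OF \<open>t \<in> {1..T}\<close> subsetD[OF \<open>A \<subseteq> _\<close> that]]
      by (simp only: atLeastAtMost_iff)
    have "E t \<le> measure_pmf.expectation (eg_law \<alpha> A U (t - 1)) (\<lambda>_. a t + M)"
      unfolding E_def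
    proof (intro integral_mono_AE)
      show "AE c in eg_law \<alpha> A U (t - 1). U t c \<le> a t + M"
        unfolding AE_measure_pmf_iff law using U_le by blast
      show "integrable (eg_law \<alpha> A U (t - 1)) (U t)"
        by (rule integrable_measure_pmf_finite) (unfold law, rule A(1))
    qed auto
    then show ?thesis by simp
  qed
  have expect: "measure_pmf.expectation (eg_plays \<alpha> A U T)
        (\<lambda>play. \<Sum>t = 1..T. ski_U (b t) (n t) (fst (play t)) (snd (play t)) - ski_U (b t) (n t) x lam)
      = (\<Sum>t = 1..T. E t - U t (x, lam))" for x lam
  proof -
    have "measure_pmf.expectation (eg_plays \<alpha> A U T) (\<lambda>play. \<Sum>t = 1..T. U t (play t) - U t (x, lam))
        = (\<Sum>t = 1..T. measure_pmf.expectation (eg_law \<alpha> A U (t - 1)) (\<lambda>c. U t c - U t (x, lam)))"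
      using expectation_eg_plays_sum[OF A(1) \<open>A \<noteq> {}\<close>, of \<alpha> U T "\<lambda>t c. U t c - U t (x, lam)"] .
    also have "\<dots> = (\<Sum>t = 1..T. E t - U t (x, lam))"
      unfolding E_def
      by (intro sum.cong refl, subst Bochner_Integration.integral_diff)
        (simp_all add: integrable_measure_pmf_finite law A)
    finally show ?thesis by (simp add: U_def case_prod_unfold)
  qed
  have regret: "ski_eg_regret \<alpha> (1 / m) N T n b
      = (SUP (x, lam) \<in> {1..N} \<times> {0<..1::real}. ereal (\<Sum>t = 1..T. E t - U t (x, lam)))"
    unfolding ski_eg_regret_def expect[symmetric] by (simp only: A_def U_def)
  show "ski_eg_regret \<alpha> (1 / m) N T n b \<le> ereal (T * M)"
    unfolding regret
  proof (rule SUP_least, clarify)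
    fix x lam assume c: "x \<in> {1..N}" "lam \<in> {0<..1::real}"
    have "(\<Sum>t = 1..T. E t - U t (x, lam)) \<le> (\<Sum>t = 1..T. M)"
    proof (rule sum_mono)
      fix t assume t: "t \<in> {1..T}"
      show "E t - U t (x, lam) \<le> M"
        using E_le[OF t] range[OF t, of "(x, lam)"] c by auto
    qed
    then show "ereal (\<Sum>t = 1..T. E t - U t (x, lam)) \<le> ereal (T * M)" by simp
  qed
  show "ski_eg_regret \<alpha> (1 / m) N T n b
      \<le> ereal (ln (real N * real m) / \<alpha> + \<alpha> * T * M\<^sup>2 / 8 + T * M / m)"
    unfolding regret
  proof (rule SUP_least, clarify)
    fix x lam assume c: "x \<in> {1..N}" "lam \<in> {0<..1::real}"
    obtain mu where mu: "mu \<in> midpoint_grid (1 / real m)"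
      "\<And>B N b n x. b \<in> {0<..B} \<Longrightarrow> n \<in> {2..N} \<Longrightarrow> x \<in> {1..N} \<Longrightarrow>
         ski_U b n x mu \<le> ski_U b n x lam + ski_range B N / m"
      using ski_U_discretization[OF \<open>m \<ge> 2\<close> c(2)] by blast
    have "(x, mu) \<in> A" using c mu by (auto simp: A_def)
    have "(\<Sum>t = 1..T. E t - U t (x, lam)) \<le> (\<Sum>t = 1..T. (E t - U t (x, mu)) + M / m)"
    proof (rule sum_mono)
      fix t assume "t \<in> {1..T}"
      then show "E t - U t (x, lam) \<le> (E t - U t (x, mu)) + M / m"
        using mu(2)[of "b t" B "n t" N x] inst[of t] c by (auto simp: U_def M_def)
    qed
    also have "\<dots> = (\<Sum>t = 1..T. E t - U t (x, mu)) + T * M / m"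
      by (simp add: sum.distrib)
    also have "(\<Sum>t = 1..T. E t - U t (x, mu)) \<le> ln (card A) / \<alpha> + \<alpha> * T * M\<^sup>2 / 8"
      unfolding E_def using A \<open>(x, mu) \<in> A\<close> \<open>\<alpha> > 0\<close> range \<open>A \<subseteq> _\<close>
      by (intro eg_law_regret[where a = a]) blast+
    finally show "ereal (\<Sum>t = 1..T. E t - U t (x, lam))
        \<le> ereal (ln (real N * real m) / \<alpha> + \<alpha> * T * M\<^sup>2 / 8 + T * M / m)"
      by (simp add: A)
  qed
qed

section \<open>The regret bound\<close>

text \<open>This is \<open>2 * s \<le> s\<^sup>2 + 1\<close> at \<open>s = sqrt T\<close>.\<close>

lemma div_Suc_le_half_sqrt:
  "real T / (real T + 1) \<le> sqrt (real T) / 2"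
proof -
  define s where "s = sqrt (real T)"
  have T: "real T = s\<^sup>2" "s \<ge> 0" by (simp_all add: s_def)
  have "s * (2 * s) \<le> s * (s\<^sup>2 + 1)"
    using sum_squares_bound[of s 1] T by (intro mult_left_mono) auto
  moreover have "s * s + 1 > 0" by (simp add: add_nonneg_pos)
  ultimately have "s\<^sup>2 / (s\<^sup>2 + 1) \<le> s / 2"
    by (simp add: field_simps power2_eq_square)
  then show ?thesis by (simp add: T flip: s_def)
qed

theorem corollary6p2:
  fixes N T :: nat and B :: real
  assumes "N \<ge> 2" and "B > 0" and "T \<ge> 1"
    and nondegenerate: "B * real N * real T \<ge> 101 / 100"
  shows "\<exists>\<alpha> \<delta> :: real. \<alpha> > 0 \<and> \<delta> > 0 \<and> (\<exists>m::nat. m \<ge> 2 \<and> 1 / \<delta> = real m) \<and>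
    (\<forall>(n :: nat \<Rightarrow> nat) (b :: nat \<Rightarrow> real).
       (\<forall>t\<in>{1..T}. n t \<in> {2..N} \<and> b t \<in> {0<..B}) \<longrightarrow>
       ski_eg_regret \<alpha> \<delta> N T n b \<le> ereal (6 * real N * sqrt (real T * ln (B * real N * real T))))"
proof -
  define Y where "Y = B * real N * real T"
  define M where "M = ski_range B N"
  \<comment> \<open>The number of grid actions when \<open>m = T + 1\<close>.\<close>
  define K where "K = real N * real (T + 1)"
  have Y: "Y \<ge> 101 / 100" using nondegenerate by (simp add: Y_def)
  have "M > 0" using assms by (simp add: M_def ski_range_def)
  have "K > 1"
    using mult_mono[of 2 "real N" 2 "real (T + 1)"] assms by (simp add: K_def)
  have lnY: "ln Y \<ge> 1 - 1 / Y"
    using ln_le_minus_one[of "1 / Y"] Y by (simp add: ln_div)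
  \<comment> \<open>For \<open>B < 1\<close> the bound \<open>T * B = Y / N\<close> suffices once
    \<open>Y \<le> 6 * N\<^sup>2 * sqrt (T * ln Y)\<close>; as \<open>N\<^sup>2 \<ge> 4\<close>, the
    constant is \<open>24\<^sup>2 = 576\<close>. The left side of \<open>learn\<close> is the regret
    bound at the optimal step-size.\<close>
  consider (trivial) "B < 1" "Y\<^sup>2 \<le> 576 * T * ln Y"
    | (learn) "M * sqrt (T * ln K / 2) + T * M / (T + 1) \<le> 6 * real N * sqrt (T * ln Y)"
  proof (cases "B < 1")
    case True
    show thesis
    proof (cases "Y\<^sup>2 \<le> 576 * T * ln Y")
      case False
      have "576 * ln Y * 1 \<le> 576 * ln Y * T"
        using assms Y by (intro mult_left_mono) auto
      with False have "576 * ln Y < Y\<^sup>2" by (simp add: mult_ac)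
      moreover have "576 * (1 - 1 / Y) \<le> 576 * ln Y" using lnY by (intro mult_left_mono) auto
      ultimately have *: "576 * (1 - 1 / Y) < Y\<^sup>2" by linarith
      define Z where "Z = Y * (Y * Y)"
      have cubic: "576 * Y - 576 < Z"
        using * Y by (simp add: Z_def field_simps power2_eq_square)
      \<comment> \<open>Bootstrapping on the cubic: \<open>Y \<le> 20\<close> forces
        \<open>Y \<le> 4\<close>, then \<open>Y \<le> 36 / 35\<close>, hence \<open>Z < 2\<close>;
        but the margin in \<open>nondegenerate\<close> gives
        \<open>576 * Y - 576 \<ge> 5.76\<close>.\<close>
      have "Y > 20"
      proof (rule ccontr)
        assume "\<not> 20 < Y"
        with Y have "Z \<le> Y * (20 * 20)" unfolding Z_def by (intro mult_left_mono mult_mono) auto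
        then have "Z \<le> 400 * Y" by simp
        with cubic have "Y \<le> 4" by linarith
        with Y have "Z \<le> Y * (4 * 4)" unfolding Z_def by (intro mult_left_mono mult_mono) auto
        then have "Z \<le> 16 * Y" by simp
        with cubic have "Y \<le> 36 / 35" by linarith
        with Y have "Z \<le> 36 / 35 * (36 / 35 * (36 / 35))" unfolding Z_def by (intro mult_mono) auto
        with cubic Y show False by (simp add: field_simps)
      qed
      have "exp 1 \<le> Y" using exp_le \<open>Y > 20\<close> by simp
      then have "ln Y \<ge> 1" using \<open>Y > 20\<close> by (simp add: ln_ge_iff)
      have "1 * real T \<le> 576 * ln Y * T" using \<open>ln Y \<ge> 1\<close> by (intro mult_right_mono) auto
      with False have "T \<le> Y\<^sup>2" by (simp add: mult_ac)
      have "ln K \<le> ln (real N * (2 * Y\<^sup>2))"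
      proof -
        have "K \<le> real N * (2 * Y\<^sup>2)"
          unfolding K_def using assms \<open>T \<le> Y\<^sup>2\<close> by (intro mult_left_mono) auto
        then show ?thesis using \<open>K > 1\<close> by simp
      qed
      also have "\<dots> = ln (real N) + ln 2 + 2 * ln Y"
        using assms Y by (simp add: ln_mult ln_realpow)
      also have "\<dots> \<le> real N + 2 * ln Y"
        using assms ln_le_minus_one[of "real N"] ln_le_minus_one[of 2] by simp
      also have "\<dots> \<le> real N * ln Y + real N * ln Y"
        using assms \<open>ln Y \<ge> 1\<close> by (intro add_mono mult_right_mono) auto
      \<comment> \<open>A crude square, so that the root yields a factor \<open>N\<close>.\<close>
      also have "\<dots> \<le> (real N)\<^sup>2 * (2 * ln Y)"
        using assms \<open>ln Y \<ge> 1\<close> mult_right_mono[of 1 "real N" "2 * (real N * ln Y)"]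
        by (simp add: power2_eq_square mult_ac)
      finally have "T * ln K / 2 \<le> (real N)\<^sup>2 * (T * ln Y)"
        using mult_left_mono[of "ln K" "(real N)\<^sup>2 * (2 * ln Y)" "real T"] by (simp add: mult_ac)
      then have "sqrt (T * ln K / 2) \<le> sqrt ((real N)\<^sup>2 * (T * ln Y))"
        by (rule real_sqrt_le_mono)
      then have *: "sqrt (T * ln K / 2) \<le> real N * sqrt (T * ln Y)"
        by (simp add: real_sqrt_mult)
      have "M \<le> 1" using True by (simp add: M_def ski_range_def)
      have "1 * 1 \<le> real T * ln Y" using assms \<open>ln Y \<ge> 1\<close> by (intro mult_mono) auto
      then have "1 * 1 \<le> real N * sqrt (T * ln Y)"
        using assms by (intro mult_mono) auto
      moreover have "M * sqrt (T * ln K / 2) \<le> 1 * (real N * sqrt (T * ln Y))"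
        using \<open>M \<le> 1\<close> \<open>K > 1\<close> by (intro mult_mono *) auto
      moreover have "T * M / (T + 1) \<le> 1"
      proof -
        have "T * M \<le> real T * 1" using \<open>M \<le> 1\<close> by (intro mult_left_mono) auto
        then show ?thesis by simp
      qed
      ultimately show thesis by (intro learn) linarith
    qed (use True trivial in blast)
  next
    case False
    have "2 * 1 \<le> real N * real T" using assms by (intro mult_mono) auto
    moreover have NT: "real N * real T \<le> Y"
      using False mult_right_mono[of 1 B "real N * real T"] by (simp add: Y_def mult_ac)
    ultimately have "Y \<ge> 2" by simp
    then have "1 / Y \<le> 1 / 2" by (simp add: field_simps)
    with lnY have "ln Y \<ge> 1 / 2" by linarith
    have "2 * T \<le> N * T" using assms by (intro mult_le_mono1)
    with \<open>T \<ge> 1\<close> have "T + 1 \<le> N * T" by linarith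
    then have "real (T + 1) \<le> real N * real T" by (metis of_nat_mono of_nat_mult)
    moreover have "real N \<le> real N * real T" using assms by simp
    \<comment> \<open>Thus \<open>ln K / 2 \<le> ln Y\<close>. Learning and rounding then each cost
      at most \<open>3 * N * sqrt (T * ln Y)\<close>, which gives the constant 6.\<close>
    ultimately have "K \<le> Y * Y"
      unfolding K_def using NT by (intro mult_mono) auto
    then have "ln K \<le> ln (Y * Y)" using \<open>K > 1\<close> by simp
    also have "\<dots> = 2 * ln Y" using Y by (simp add: ln_mult)
    finally have "T * ln K / 2 \<le> T * ln Y" using mult_left_mono[of "ln K" "2 * ln Y" "real T / 2"] by simp
    then have "sqrt (T * ln K / 2) \<le> sqrt (T * ln Y)" by (rule real_sqrt_le_mono)
    moreover have "real T / (real T + 1) \<le> sqrt (T * ln Y)"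
    proof -
      have "real T / (real T + 1) \<le> sqrt (real T) / 2" by (rule div_Suc_le_half_sqrt)
      also have "\<dots> = sqrt (T * (1 / 4))" by (simp add: real_sqrt_mult real_sqrt_divide)
      also have "\<dots> \<le> sqrt (T * ln Y)"
        using \<open>ln Y \<ge> 1 / 2\<close> by (intro real_sqrt_le_mono mult_left_mono) auto
      finally show ?thesis .
    qed
    ultimately have "3 * real N * (sqrt (T * ln K / 2) + real T / (real T + 1))
        \<le> 3 * real N * (sqrt (T * ln Y) + sqrt (T * ln Y))"
      by (intro mult_left_mono add_mono) auto
    then show thesis
      using False by (intro learn) (simp add: M_def ski_range_def algebra_simps)
  qed
  then show ?thesis
  proof cases
    case trivial
    have "T * M \<le> 6 * real N * sqrt (T * ln Y)"
    proof -
      have "Y \<le> sqrt (576 * T * ln Y)" using trivial(2) Y by (intro real_le_rsqrt) 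
      also have "\<dots> = 24 * sqrt (T * ln Y)"
        using real_sqrt_abs[of 24] by (simp add: real_sqrt_mult)
      finally have *: "Y \<le> 24 * sqrt (T * ln Y)" .
      have "4 * (T * M) \<le> real N * real N * (T * M)"
        using assms \<open>M > 0\<close> mult_mono[of 2 "real N" 2 "real N"] by (intro mult_right_mono) auto
      also have "\<dots> = real N * Y"
        using trivial by (simp add: Y_def M_def ski_range_def)
      also have "\<dots> \<le> real N * (24 * sqrt (T * ln Y))"
        by (intro mult_left_mono *) auto
      finally show ?thesis by (simp add: mult_ac)
    qed
    \<comment> \<open>The trivial bound holds for every step-size and grid; \<open>1\<close> and
      \<open>1 / 2\<close> are arbitrary.\<close>
    then have "ski_eg_regret 1 (1 / real 2) N T n b \<le> ereal (6 * real N * sqrt (T * ln Y))"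
      if "\<forall>t\<in>{1..T}. n t \<in> {2..N} \<and> b t \<in> {0<..B}" for n b
      using ski_regret_le(1)[of T n N b B 2 1] that assms unfolding M_def
      by (meson order_trans ereal_less_eq(3) zero_less_one order_refl)
    then show ?thesis
      unfolding Y_def by (intro exI[of _ 1] exI[of _ "1 / real 2"]) auto
  next
    case learn
    \<comment> \<open>The minimizer of
      \<open>ln K / \<alpha> + \<alpha> * T * M\<^sup>2 / 8\<close>; it makes both terms
      equal.\<close>
    define \<alpha> where "\<alpha> = sqrt (8 * ln K / T) / M"
    have "ln K > 0" using \<open>K > 1\<close> by simp
    then have "\<alpha> > 0" using assms \<open>M > 0\<close> by (simp add: \<alpha>_def)
    have opt: "ln K / \<alpha> + \<alpha> * T * M\<^sup>2 / 8 = M * sqrt (T * ln K / 2)"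
    proof -
      define r where "r = sqrt (T * ln K / 2)"
      have r: "r > 0" "ln K = 2 * r\<^sup>2 / T"
        using assms \<open>ln K > 0\<close> by (simp_all add: r_def)
      have "sqrt (8 * ln K / T) = sqrt ((4 * r / T)\<^sup>2)"
        unfolding r(2) by (simp add: power_divide power2_eq_square)
      then have \<alpha>: "\<alpha> = 4 * r / T / M"
        using r by (simp add: \<alpha>_def)
      have "ln K / \<alpha> = M * r / 2" "\<alpha> * T * M\<^sup>2 / 8 = M * r / 2"
        unfolding \<alpha> r(2) using r(1) assms \<open>M > 0\<close> by (simp_all add: field_simps power2_eq_square)
      then show ?thesis
        by (simp add: r_def)
    qed
    have "ski_eg_regret \<alpha> (1 / real (T + 1)) N T n b \<le> ereal (6 * real N * sqrt (T * ln Y))"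
      if "\<forall>t\<in>{1..T}. n t \<in> {2..N} \<and> b t \<in> {0<..B}" for n b
    proof -
      have "ski_eg_regret \<alpha> (1 / real (T + 1)) N T n b
          \<le> ereal (ln K / \<alpha> + \<alpha> * T * M\<^sup>2 / 8 + T * M / real (T + 1))"
        unfolding K_def M_def
        by (rule ski_regret_le(2)) (use that assms \<open>\<alpha> > 0\<close> in auto)
      also have "\<dots> \<le> ereal (6 * real N * sqrt (T * ln Y))"
        using learn by (simp add: opt add_ac)
      finally show ?thesis .
    qed
    then show ?thesis
      unfolding Y_def
      by (intro exI[of _ \<alpha>] exI[of _ "1 / real (T + 1)"])
        (use \<open>\<alpha> > 0\<close> assms in \<open>auto intro!: exI[of _ "T + 1"]\<close>)
  qed
qed

end
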